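(* Let $m,n$ be positive integers with $n\mid m$, let $V$ be a vertex set with $|V|=m$, and let $\mathcal{T}=\{T_1,\dots,T_t\}$ be a collection of trees on $V$ with $|V(T_i)|=n$ for each $i\in[t]$. If $\mathcal{T}$ contains no rainbow tree of order $n$, then $t\le \frac{m(n-2)}{n}$. Moreover, this bound is attained, and the set of all such collections $\mathcal{T}$ (containing no rainbow tree of order $n$) with $t=\frac{m(n-2)}{n}$ is exactly $\mathfrak{B}(n,m)$.
   Context: A tree on $V$ is a tree whose vertex set is a subset of $V$; its order is its number of vertices. The collection $\mathcal{T}$ is a finite family whose members need not be distinct. $\mathcal{T}$ contains a rainbow tree of order $n$ if there is a tree with $n$ vertices whose $n-1$ edges can be assigned injectively to indices $i\in[t]$ so that each edge is an edge of the assigned $T_i$ (at most one edge from each $T_i$). $\mathfrak{B}(n,m)$ denotes the set of collections of $m(n-2)/n$ trees on $V$ (with $|V|=m$) for which there is a partition of $V$ into $m/n$ parts $V_1,\dots,V_{m/n}$ with $|V_i|=n$ for all $i$, such that the collection consists of exactly $n-2$ spanning trees of $V_i$ for each $i$ (i.e. exactly $n-2$ members have vertex set $V_i$).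
   Formalization: The claim that the bound is attained is stated only for n ≥ 2: for n = 1 the bound m(n−2)/n equals −m, which is negative, so no collection can attain it; the upper bound and the equality of sets cover all positive n. *)

theory Defs
  imports Complex_Main "HOL-Library.Disjoint_Sets"
begin

text \<open>
  A simple undirected graph is a pair of a vertex set and a set of two-element sets of vertices.
  The AFP entry \<open>Graph_Theory\<close> is about directed graphs, and its \<open>tree\<close> only excludes directed
  cycles, so it does not describe undirected trees.
\<close>

type_synonym 'a ugraph = "'a set \<times> 'a set set"

abbreviation uverts :: "'a ugraph \<Rightarrow> 'a set" where
  "uverts G \<equiv> fst G"

abbreviation uedges :: "'a ugraph \<Rightarrow> 'a set set" where
  "uedges G \<equiv> snd G"

definition simple_graph :: "'a ugraph \<Rightarrow> bool" where
  "simple_graph G \<longleftrightarrow> finite (uverts G) \<and> (\<forall>e\<in>uedges G. e \<subseteq> uverts G \<and> card e = 2)"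

definition connected_graph :: "'a ugraph \<Rightarrow> bool" where
  "connected_graph G \<longleftrightarrow> uverts G \<noteq> {} \<and>
     (\<forall>u\<in>uverts G. \<forall>v\<in>uverts G. (u, v) \<in> {(x, y). {x, y} \<in> uedges G}\<^sup>*)"

text \<open>A cycle is given by its cyclic list of pairwise distinct vertices.\<close>

definition is_cycle :: "'a ugraph \<Rightarrow> 'a list \<Rightarrow> bool" where
  "is_cycle G c \<longleftrightarrow> length c \<ge> 3 \<and> distinct c \<and>
     (\<forall>i<length c. {c ! i, c ! (Suc i mod length c)} \<in> uedges G)"

definition is_tree :: "'a ugraph \<Rightarrow> bool" where
  "is_tree G \<longleftrightarrow> simple_graph G \<and> connected_graph G \<and> (\<nexists>c. is_cycle G c)"

definition tree_on :: "'a set \<Rightarrow> 'a ugraph \<Rightarrow> bool" where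
  "tree_on V T \<longleftrightarrow> is_tree T \<and> uverts T \<subseteq> V"

abbreviation graph_order :: "'a ugraph \<Rightarrow> nat" where
  "graph_order G \<equiv> card (uverts G)"

text \<open>
  A collection of trees is a list, so that members may repeat; its index set is
  \<open>{0..<length Ts}\<close>. The function \<open>f\<close> assigns to each edge of the rainbow tree the index of the
  member it is taken from.
\<close>

definition contains_rainbow_tree :: "'a set \<Rightarrow> 'a ugraph list \<Rightarrow> nat \<Rightarrow> bool" where
  "contains_rainbow_tree V Ts n \<longleftrightarrow>
     (\<exists>S f. tree_on V S \<and> graph_order S = n \<and> inj_on f (uedges S) \<and>
        (\<forall>e\<in>uedges S. f e < length Ts \<and> e \<in> uedges (Ts ! f e)))"

text \<open>
  The set \<open>\<BB>(n,m)\<close> over the vertex set \<open>V\<close>. Numbers are compared in \<open>real\<close> and \<open>int\<close> because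
  \<open>n - 2\<close> is negative for \<open>n = 1\<close>; the set is then empty.
\<close>

definition extremal_collections :: "'a set \<Rightarrow> nat \<Rightarrow> nat \<Rightarrow> 'a ugraph list set" where
  "extremal_collections V n m =
     {Ts. (\<forall>T\<in>set Ts. tree_on V T) \<and>
          real (length Ts) = real m * (real n - 2) / real n \<and>
          (\<exists>P. partition_on V P \<and> real (card P) = real m / real n \<and> (\<forall>X\<in>P. card X = n) \<and>
             (\<forall>X\<in>P. int (card {i. i < length Ts \<and> uverts (Ts ! i) = X}) = int n - 2))}"

end

theory Submission
  imports Defs
begin

text \<open>
  If a vertex \<open>v\<close> lies in \<open>k < n\<close> trees of order \<open>n\<close>, a rainbow tree of order \<open>k + 1\<close> through \<open>v\<close>
  is grown greedily: each of these trees meets the current tree and is larger, so it has an edge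
  leaving it. Without a rainbow tree of order \<open>n\<close>, every vertex thus lies in at most \<open>n - 2\<close> members,
  and double counting incidences gives \<open>t n \<le> m (n - 2)\<close>.

  In the case of equality every vertex lies in exactly \<open>n - 2\<close> members. The rainbow tree \<open>S\<close> of order
  \<open>n - 1\<close> grown from \<open>v\<close> uses only members through \<open>v\<close>, so no other member meets \<open>S\<close>; hence all
  vertices of \<open>S\<close> lie in the same members as \<open>v\<close>. If a member contains two vertices \<open>v\<close>, \<open>w\<close>, then
  the two sets of \<open>n - 1\<close> vertices obtained in this way lie in that member and overlap, as \<open>n \<ge> 3\<close>.
  So \<open>v\<close> and \<open>w\<close> lie in the same members, which means that any two members have equal or disjoint
  vertex sets. Conversely, in an extremal collection a rainbow tree of order \<open>n\<close> would stay inside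
  one part, where only \<open>n - 2\<close> members are available for its \<open>n - 1\<close> edges.
\<close>

section \<open>Crossing edges and edge counts of connected graphs\<close>

lemma rtrancl_crossing:
  assumes "(u, w) \<in> R\<^sup>*" "u \<in> W" "w \<notin> W"
  shows "\<exists>x y. (x, y) \<in> R \<and> x \<in> W \<and> y \<notin> W"
  using assms by (induction rule: rtrancl_induct) blast+

text \<open>A path from a vertex in \<open>W\<close> to one outside leaves \<open>W\<close> at some
  edge. \<open>W\<close> is arbitrary, so it can be the vertex set of a growing tree or a part of a
  partition.\<close>

lemma connected_graph_crossing_edge:
  assumes "connected_graph G" "W \<inter> uverts G \<noteq> {}" "\<not> uverts G \<subseteq> W"
  obtains x y where "{x, y} \<in> uedges G" "x \<in> W" "y \<notin> W"
proof -
  obtain u w where "u \<in> W" "u \<in> uverts G" "w \<in> uverts G" "w \<notin> W"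
    using assms by blast
  moreover from this have "(u, w) \<in> {(x, y). {x, y} \<in> uedges G}\<^sup>*"
    using assms(1) by (simp add: connected_graph_def)
  ultimately show ?thesis
    using rtrancl_crossing[of u w "{(x, y). {x, y} \<in> uedges G}" W] that by blast
qed

lemma simple_graph_finite_edges:
  assumes "simple_graph G"
  shows "finite (uedges G)"
proof (rule finite_subset)
  show "uedges G \<subseteq> Pow (uverts G)" "finite (Pow (uverts G))"
    using assms by (auto simp: simple_graph_def)
qed

text \<open>From a single vertex, every further vertex is reached by a crossing edge. This yields
  the \<open>n - 1\<close> edges that a rainbow tree of order \<open>n\<close> has to
  colour.\<close>

lemma connected_graph_card_le:
  assumes "connected_graph G" "simple_graph G"
  shows "card (uverts G) \<le> Suc (card (uedges G))"
proof -
  have fin: "finite (uverts G)" and edge: "\<And>e. e \<in> uedges G \<Longrightarrow> e \<subseteq> uverts G"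
    and finE: "finite (uedges G)"
    using assms(2) simple_graph_finite_edges[OF assms(2)] by (auto simp: simple_graph_def)
  obtain v where v: "v \<in> uverts G"
    using assms(1) by (auto simp: connected_graph_def)
  \<comment> \<open>The clause \<open>\<Union>F \<subseteq> W\<close> guarantees that the next
    crossing edge is not yet in \<open>F\<close>.\<close>
  have grow: "\<exists>W F. W \<subseteq> uverts G \<and> card W = Suc k \<and> F \<subseteq> uedges G \<and> card F = k \<and> \<Union>F \<subseteq> W"
    if "k < card (uverts G)" for k
    using that
  proof (induction k)
    case 0
    show ?case
      by (rule exI[of _ "{v}"], rule exI[of _ "{}"]) (use v in auto)
  next
    case (Suc k)
    then obtain W F where WF: "W \<subseteq> uverts G" "card W = Suc k" "F \<subseteq> uedges G" "card F = k" "\<Union>F \<subseteq> W"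
      by auto
    have finW: "finite W" "finite F"
      using WF finE fin finite_subset by blast+
    have "W \<inter> uverts G \<noteq> {}"
      using WF(1,2) by (auto simp: Int_absorb2)
    moreover have "\<not> uverts G \<subseteq> W"
      using card_mono[OF finW(1), of "uverts G"] WF(2) Suc.prems by linarith
    ultimately obtain x y where xy: "{x, y} \<in> uedges G" "x \<in> W" "y \<notin> W"
      using connected_graph_crossing_edge assms(1) by metis
    have "{x, y} \<notin> F"
      using xy(3) WF(5) by blast
    then have "card (insert {x, y} F) = Suc k" "card (insert y W) = Suc (Suc k)"
      using finW WF(2,4) xy(3) by auto
    moreover have "insert y W \<subseteq> uverts G" "insert {x, y} F \<subseteq> uedges G"
      "\<Union>(insert {x, y} F) \<subseteq> insert y W"
      using WF xy edge[OF xy(1)] by auto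
    ultimately show ?case
      by blast
  qed
  show ?thesis
  proof (cases "card (uverts G)")
    case (Suc k)
    then obtain F where "F \<subseteq> uedges G" "card F = k"
      using grow[of k] by auto
    then show ?thesis
      using card_mono[OF finE] Suc by fastforce
  qed simp
qed

section \<open>Trees grown leaf by leaf\<close>

lemma is_tree_singleton: "is_tree ({v}, {})"
  by (force simp: is_tree_def simple_graph_def connected_graph_def is_cycle_def)

text \<open>A cycle through \<open>y\<close> would need two different neighbours of
  \<open>y\<close>, but \<open>x\<close> is the only one; a cycle avoiding \<open>y\<close> would
  already lie in the old tree.\<close>

lemma is_tree_add_leaf:
  assumes tree: "is_tree (W, F)" and x: "x \<in> W" and y: "y \<notin> W"
  shows "is_tree (insert y W, insert {x, y} F)"
proof -
  have edge: "e \<subseteq> W" "card e = 2" if "e \<in> F" for e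
    using tree that by (auto simp: is_tree_def simple_graph_def)
  have "x \<noteq> y"
    using x y by blast
  then have simple: "simple_graph (insert y W, insert {x, y} F)"
    using tree x by (auto simp: is_tree_def simple_graph_def)
  define R where "R = {(a, b). {a, b} \<in> F}"
  define R' where "R' = {(a, b). {a, b} \<in> insert {x, y} F}"
  have mono: "R\<^sup>* \<subseteq> R'\<^sup>*"
    by (rule rtrancl_mono) (auto simp: R_def R'_def)
  have R: "(u, w) \<in> R\<^sup>*" if "u \<in> W" "w \<in> W" for u w
    using tree that by (auto simp: is_tree_def connected_graph_def R_def)
  have xy: "(x, y) \<in> R'" "(y, x) \<in> R'"
    by (auto simp: R'_def insert_commute)
  have via_x: "(u, x) \<in> R'\<^sup>* \<and> (x, u) \<in> R'\<^sup>*" if "u \<in> insert y W" for u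
    using that R[of u x] R[of x u] mono xy x by blast
  then have "(u, w) \<in> R'\<^sup>*" if "u \<in> insert y W" "w \<in> insert y W" for u w
    using that by (meson rtrancl_trans)
  then have connected: "connected_graph (insert y W, insert {x, y} F)"
    by (simp add: connected_graph_def R'_def)
  have acyclic: False if c: "is_cycle (insert y W, insert {x, y} F) c" for c
  proof -
    let ?l = "length c"
    have l: "?l \<ge> 3" "distinct c"
      and ce: "\<And>i. i < ?l \<Longrightarrow> {c ! i, c ! (Suc i mod ?l)} \<in> insert {x, y} F"
      using c by (auto simp: is_cycle_def)
    show False
    proof (cases "y \<in> set c")
      case False
      have "{c ! i, c ! (Suc i mod ?l)} \<in> F" if "i < ?l" for i
      proof -
        have "Suc i mod ?l < ?l"
          using l(1) by (intro mod_less_divisor) linarith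
        then have "c ! i \<noteq> y" "c ! (Suc i mod ?l) \<noteq> y"
          using that False nth_mem by metis+
        then show ?thesis
          using ce[OF that] by (auto simp: doubleton_eq_iff)
      qed
      then have "is_cycle (W, F) c"
        using l by (simp add: is_cycle_def)
      then show False
        using tree by (auto simp: is_tree_def)
    next
      case True
      then obtain i where i: "i < ?l" "c ! i = y"
        by (auto simp: in_set_conv_nth)
      define j where "j = (if i = 0 then ?l - 1 else i - 1)"
      have j: "j < ?l" "Suc j mod ?l = i"
        using i l(1) by (auto simp: j_def)
      \<comment> \<open>As \<open>?l \<ge> 3\<close>, the cyclic predecessor \<open>j\<close> and
        the successor of \<open>i\<close> are different positions; both will turn out to carry
        \<open>x\<close>.\<close>
      have ne: "Suc i mod ?l \<noteq> j" and lt: "Suc i mod ?l < ?l"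
        using i(1) l(1) by (auto simp: j_def mod_Suc)
      have not_F: "e \<notin> F" if "y \<in> e" for e
        using that edge(1) y by blast
      have "{y, c ! (Suc i mod ?l)} = {x, y}" "{c ! j, y} = {x, y}"
        using ce[OF i(1)] ce[OF j(1)] i(2) j(2) not_F by auto
      then have "c ! (Suc i mod ?l) = c ! j"
        by (metis doubleton_eq_iff)
      then show False
        using ne lt j(1) l(2) by (simp add: nth_eq_iff_index_eq)
    qed
  qed
  show ?thesis
    using simple connected acyclic by (auto simp: is_tree_def)
qed

lemma ex_is_tree_spanning:
  assumes "finite X" "X \<noteq> {}"
  shows "\<exists>T. is_tree T \<and> uverts T = X"
  using assms
proof (induction rule: finite_ne_induct)
  case (singleton v)
  show ?case
    using is_tree_singleton[of v] by (intro exI[of _ "({v}, {})"]) simp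
next
  case (insert y W)
  then obtain F x where "is_tree (W, F)" "x \<in> W"
    by auto
  then show ?case
    using is_tree_add_leaf[of W F x y] insert.hyps
    by (intro exI[of _ "(insert y W, insert {x, y} F)"]) simp
qed

section \<open>Rainbow trees grown through a vertex\<close>

text \<open>The set \<open>I\<close> of permitted indices is explicit, so that any index outside
  \<open>I\<close> is known to be a fresh colour.\<close>

definition rainbow_tree ::
  "'a set \<Rightarrow> 'a ugraph list \<Rightarrow> nat set \<Rightarrow> 'a ugraph \<Rightarrow> ('a set \<Rightarrow> nat) \<Rightarrow> bool" where
  "rainbow_tree V Ts I S f \<longleftrightarrow> tree_on V S \<and> inj_on f (uedges S) \<and> f ` uedges S \<subseteq> I \<and>
     (\<forall>e\<in>uedges S. e \<in> uedges (Ts ! f e))"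

lemma contains_rainbow_treeI:
  assumes "rainbow_tree V Ts I S f" "I \<subseteq> {..<length Ts}" "graph_order S = n"
  shows "contains_rainbow_tree V Ts n"
  using assms unfolding rainbow_tree_def contains_rainbow_tree_def by fast

text \<open>Member \<open>i\<close> is connected, meets \<open>S\<close> and has more vertices, so
  one of its edges leaves \<open>S\<close>. That edge becomes a leaf edge of colour
  \<open>i\<close>.\<close>

lemma rainbow_tree_extend:
  assumes S: "rainbow_tree V Ts I S f" and i: "i \<notin> I" and T: "tree_on V (Ts ! i)"
    and order: "graph_order S < graph_order (Ts ! i)" and meet: "uverts S \<inter> uverts (Ts ! i) \<noteq> {}"
  shows "\<exists>S' f'. rainbow_tree V Ts (insert i I) S' f' \<and> uverts S \<subseteq> uverts S' \<and>
    graph_order S' = Suc (graph_order S)"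
proof -
  obtain W F where WF: "S = (W, F)"
    by (cases S)
  have tree: "is_tree (W, F)" "W \<subseteq> V"
    using S by (auto simp: rainbow_tree_def tree_on_def WF)
  have finW: "finite W" and edge: "\<And>e. e \<in> F \<Longrightarrow> e \<subseteq> W"
    using tree by (auto simp: is_tree_def simple_graph_def)
  have "\<not> uverts (Ts ! i) \<subseteq> W"
    using order card_mono[OF finW, of "uverts (Ts ! i)"] by (auto simp: WF)
  then obtain x y where xy: "{x, y} \<in> uedges (Ts ! i)" "x \<in> W" "y \<notin> W"
    using connected_graph_crossing_edge[of "Ts ! i" W] T meet
    by (auto simp: WF tree_on_def is_tree_def)
  have "y \<in> V"
    using T xy(1) by (fastforce simp: tree_on_def is_tree_def simple_graph_def)
  define S' where "S' = (insert y W, insert {x, y} F)"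
  define f' where "f' = f({x, y} := i)"
  have new: "{x, y} \<notin> F"
    using edge xy(3) by blast
  have f'_F: "f' e = f e" if "e \<in> F" for e
    using that new by (auto simp: f'_def)
  have "tree_on V S'"
    using is_tree_add_leaf[OF tree(1) xy(2,3)] tree(2) \<open>y \<in> V\<close> by (simp add: tree_on_def S'_def)
  moreover have "inj_on f' (uedges S')"
  proof -
    have "inj_on f' F \<longleftrightarrow> inj_on f F"
      by (rule inj_on_cong) (rule f'_F)
    moreover have "f' ` F = f ` F"
      using f'_F by simp
    ultimately show ?thesis
      using S i new by (auto simp: S'_def rainbow_tree_def WF f'_def)
  qed
  moreover have "f' ` uedges S' \<subseteq> insert i I" "\<forall>e\<in>uedges S'. e \<in> uedges (Ts ! f' e)"
    using S f'_F xy(1) by (auto simp: S'_def rainbow_tree_def WF f'_def)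
  ultimately have "rainbow_tree V Ts (insert i I) S' f'"
    by (simp add: rainbow_tree_def)
  moreover have "uverts S \<subseteq> uverts S'" "graph_order S' = Suc (graph_order S)"
    using finW xy(3) by (auto simp: WF S'_def)
  ultimately show ?thesis
    by blast
qed

text \<open>Induction on \<open>I\<close>: the common vertex \<open>v\<close> makes each member meet
  the current tree, and \<open>card I < n\<close> keeps that tree smaller than the member.\<close>

lemma rainbow_tree_grow:
  assumes "finite I" "v \<in> V" "card I < n"
    and "\<And>i. i \<in> I \<Longrightarrow> tree_on V (Ts ! i) \<and> graph_order (Ts ! i) = n \<and> v \<in> uverts (Ts ! i)"
  shows "\<exists>S f. rainbow_tree V Ts I S f \<and> v \<in> uverts S \<and> graph_order S = Suc (card I)"
  using assms
proof (induction I)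
  case empty
  show ?case
    by (rule exI[of _ "({v}, {})"])
      (use is_tree_singleton[of v] empty.prems in \<open>auto simp: rainbow_tree_def tree_on_def\<close>)
next
  case (insert i I)
  then obtain S f where S: "rainbow_tree V Ts I S f" "v \<in> uverts S" "graph_order S = Suc (card I)"
    by auto
  have "graph_order S < graph_order (Ts ! i)" "uverts S \<inter> uverts (Ts ! i) \<noteq> {}"
    using S insert.prems insert.hyps by auto
  then obtain S' f' where "rainbow_tree V Ts (insert i I) S' f'" "uverts S \<subseteq> uverts S'"
    "graph_order S' = Suc (graph_order S)"
    using rainbow_tree_extend[OF S(1) insert.hyps(2)] insert.prems(3) by blast
  then show ?case
    using S insert.hyps by (intro exI[of _ S'] exI[of _ f']) auto
qed

section \<open>Degrees and double counting\<close>

definition members_at :: "'a ugraph list \<Rightarrow> 'a \<Rightarrow> nat set" where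
  "members_at Ts v = {i. i < length Ts \<and> v \<in> uverts (Ts ! i)}"

lemma finite_members_at [simp]: "finite (members_at Ts v)"
  by (simp add: members_at_def)

text \<open>Counts the incidences of vertices with members in two ways.\<close>

lemma sum_card_members_at:
  assumes "finite V" "\<forall>T\<in>set Ts. tree_on V T \<and> graph_order T = n"
  shows "(\<Sum>v\<in>V. card (members_at Ts v)) = length Ts * n"
proof -
  have "(\<Sum>v\<in>V. card (members_at Ts v)) = (\<Sum>v\<in>V. \<Sum>i | i \<in> {..<length Ts} \<and> v \<in> uverts (Ts ! i). 1)"
    by (simp add: members_at_def)
  also have "\<dots> = (\<Sum>i<length Ts. \<Sum>v | v \<in> V \<and> v \<in> uverts (Ts ! i). 1)"
    using assms(1) by (intro sum.swap_restrict) auto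
  also have "\<dots> = (\<Sum>i<length Ts. n)"
  proof (rule sum.cong[OF refl])
    fix i assume "i \<in> {..<length Ts}"
    then have "tree_on V (Ts ! i)" "graph_order (Ts ! i) = n"
      using assms(2) by auto
    moreover from this have "{v. v \<in> V \<and> v \<in> uverts (Ts ! i)} = uverts (Ts ! i)"
      by (auto simp: tree_on_def)
    ultimately show "(\<Sum>v | v \<in> V \<and> v \<in> uverts (Ts ! i). 1) = n"
      by simp
  qed
  finally show ?thesis
    by simp
qed

text \<open>Any \<open>n - 1\<close> members through \<open>v\<close> would grow a rainbow tree of
  order \<open>n\<close>. The form \<open>+ 2 \<le> n\<close> avoids truncated subtraction; for
  \<open>n = 1\<close> the grown tree is just \<open>v\<close>, a contradiction.\<close>

lemma card_members_at_le:
  assumes Ts: "\<forall>T\<in>set Ts. tree_on V T \<and> graph_order T = n"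
    and no_rainbow: "\<not> contains_rainbow_tree V Ts n" and v: "v \<in> V" and n: "n > 0"
  shows "card (members_at Ts v) + 2 \<le> n"
proof (rule ccontr)
  assume "\<not> ?thesis"
  then have "n - 1 \<le> card (members_at Ts v)"
    by linarith
  then obtain I where I: "I \<subseteq> members_at Ts v" "card I = n - 1" "finite I"
    by (rule obtain_subset_with_card_n)
  have "tree_on V (Ts ! i) \<and> graph_order (Ts ! i) = n \<and> v \<in> uverts (Ts ! i)" if "i \<in> I" for i
    using that I(1) Ts by (auto simp: members_at_def)
  then obtain S f where S: "rainbow_tree V Ts I S f" "graph_order S = Suc (card I)"
    using rainbow_tree_grow[of I v V n Ts] I v n by auto
  have "contains_rainbow_tree V Ts n"
    by (rule contains_rainbow_treeI[OF S(1)]) (use I n S(2) in \<open>auto simp: members_at_def\<close>)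
  then show False
    using no_rainbow by blast
qed

section \<open>Equality case: vertices lying in the same members\<close>

text \<open>\<open>W\<close> is the vertex set of the rainbow tree of order \<open>n - 1\<close>
  grown from all members through \<open>v\<close>. A member meeting \<open>W\<close> but avoiding
  \<open>v\<close> would extend it to order \<open>n\<close>.\<close>

lemma members_at_eq_on_tree:
  assumes Ts: "\<forall>T\<in>set Ts. tree_on V T \<and> graph_order T = n"
    and no_rainbow: "\<not> contains_rainbow_tree V Ts n" and v: "v \<in> V"
    and deg: "\<And>u. u \<in> V \<Longrightarrow> card (members_at Ts u) + 2 = n"
  shows "\<exists>W. W \<subseteq> V \<and> v \<in> W \<and> Suc (card W) = n \<and> (\<forall>u\<in>W. members_at Ts u = members_at Ts v)"
proof -
  have Ts_nth: "tree_on V (Ts ! i) \<and> graph_order (Ts ! i) = n" if "i < length Ts" for i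
    using that Ts by simp
  have dv: "card (members_at Ts v) + 2 = n"
    using deg v .
  have through_v: "tree_on V (Ts ! i) \<and> graph_order (Ts ! i) = n \<and> v \<in> uverts (Ts ! i)"
    if "i \<in> members_at Ts v" for i
    using that Ts_nth by (auto simp: members_at_def)
  have lt: "card (members_at Ts v) < n"
    using dv by simp
  obtain S f where S: "rainbow_tree V Ts (members_at Ts v) S f" "v \<in> uverts S"
    "graph_order S = Suc (card (members_at Ts v))"
    using rainbow_tree_grow[OF finite_members_at v lt through_v] by auto
  have sub: "uverts S \<subseteq> V"
    using S(1) by (auto simp: rainbow_tree_def tree_on_def)
  have "members_at Ts u \<subseteq> members_at Ts v" if u: "u \<in> uverts S" for u
  proof (rule subsetI, rule ccontr)
    fix i assume i: "i \<in> members_at Ts u" "i \<notin> members_at Ts v"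
    then have il: "i < length Ts" "u \<in> uverts (Ts ! i)"
      by (auto simp: members_at_def)
    have "graph_order S < graph_order (Ts ! i)" "uverts S \<inter> uverts (Ts ! i) \<noteq> {}"
      using Ts_nth[OF il(1)] u il(2) S(3) dv by auto
    then obtain S' f' where S': "rainbow_tree V Ts (insert i (members_at Ts v)) S' f'"
      "graph_order S' = Suc (graph_order S)"
      using rainbow_tree_extend[OF S(1) i(2)] Ts_nth[OF il(1)] by blast
    have "contains_rainbow_tree V Ts n"
      by (rule contains_rainbow_treeI[OF S'(1)])
        (use il S'(2) S(3) dv in \<open>auto simp: members_at_def\<close>)
    then show False
      using no_rainbow by blast
  qed
  \<comment> \<open>Equal degrees turn the inclusion into an equality.\<close>
  moreover have "card (members_at Ts u) = card (members_at Ts v)" if "u \<in> uverts S" for u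
    using deg[of u] dv sub that by fastforce
  ultimately have "\<forall>u\<in>uverts S. members_at Ts u = members_at Ts v"
    by (simp add: card_subset_eq)
  moreover have "Suc (graph_order S) = n"
    using S(3) dv by simp
  ultimately show ?thesis
    using sub S(2) by blast
qed

text \<open>Inside member \<open>i\<close>, each of \<open>v\<close> and \<open>w\<close> shares its
  members with a set of \<open>n - 1\<close> vertices; a common vertex of these two sets identifies
  the members at \<open>v\<close> and \<open>w\<close>.\<close>

lemma members_at_eq_on_member:
  assumes Ts: "\<forall>T\<in>set Ts. tree_on V T \<and> graph_order T = n"
    and no_rainbow: "\<not> contains_rainbow_tree V Ts n"
    and deg: "\<And>u. u \<in> V \<Longrightarrow> card (members_at Ts u) + 2 = n"
    and i: "i < length Ts" and v: "v \<in> uverts (Ts ! i)" and w: "w \<in> uverts (Ts ! i)"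
  shows "members_at Ts w = members_at Ts v"
proof -
  let ?X = "uverts (Ts ! i)"
  have tree: "tree_on V (Ts ! i)" and order: "card ?X = n"
    using Ts i by auto
  then have X: "?X \<subseteq> V" "finite ?X"
    by (auto simp: tree_on_def is_tree_def simple_graph_def)
  \<comment> \<open>Member \<open>i\<close> itself makes the degree \<open>n - 2\<close> of
    \<open>v\<close> positive.\<close>
  have n: "n \<ge> 3"
  proof -
    have "i \<in> members_at Ts v"
      using i v by (simp add: members_at_def)
    then have "card (members_at Ts v) > 0"
      using card_gt_0_iff[of "members_at Ts v"] by auto
    then show ?thesis
      using deg[of v] v X by auto
  qed
  have twins: "\<exists>W. W \<subseteq> ?X \<and> Suc (card W) = n \<and> (\<forall>u\<in>W. members_at Ts u = members_at Ts x)"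
    if x: "x \<in> ?X" for x
  proof -
    obtain W where W: "Suc (card W) = n" "\<forall>u\<in>W. members_at Ts u = members_at Ts x"
      using members_at_eq_on_tree[OF Ts no_rainbow _ deg, of x] x X by blast
    \<comment> \<open>Every vertex of \<open>W\<close> has the same members as \<open>x\<close>,
      hence lies in member \<open>i\<close>.\<close>
    have "i \<in> members_at Ts x"
      using i x by (simp add: members_at_def)
    then have "W \<subseteq> ?X"
      using W(2) by (auto simp: members_at_def)
    then show ?thesis
      using W by blast
  qed
  obtain A where A: "A \<subseteq> ?X" "Suc (card A) = n" "\<forall>u\<in>A. members_at Ts u = members_at Ts v"
    using twins v by blast
  obtain B where B: "B \<subseteq> ?X" "Suc (card B) = n" "\<forall>u\<in>B. members_at Ts u = members_at Ts w"
    using twins w by blast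
  \<comment> \<open>both sets miss only one of the at least three vertices of the member\<close>
  have "A \<inter> B \<noteq> {}"
  proof
    assume "A \<inter> B = {}"
    then have "card (A \<union> B) = card A + card B"
      using A B X finite_subset by (metis card_Un_disjoint)
    moreover have "card (A \<union> B) \<le> n"
      using card_mono[OF X(2), of "A \<union> B"] A(1) B(1) order by simp
    ultimately show False
      using A(2) B(2) n by linarith
  qed
  then show ?thesis
    using A(3) B(3) by blast
qed

section \<open>Partitions and the extremal collections\<close>

lemma ex_partition_on_equal_card:
  assumes "finite V" "card V = k * n" "n > 0"
  shows "\<exists>P. partition_on V P \<and> card P = k \<and> (\<forall>X\<in>P. card X = n)"
  using assms
proof (induction k arbitrary: V)
  case 0
  then show ?case
    by (intro exI[of _ "{}"]) (auto simp: partition_on_def)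
next
  case (Suc k)
  obtain X where X: "X \<subseteq> V" "card X = n" "finite X"
    using obtain_subset_with_card_n[of n V] Suc.prems by auto
  have "card (V - X) = k * n"
    using Suc.prems X by (simp add: card_Diff_subset)
  then obtain P where P: "partition_on (V - X) P" "card P = k" "\<forall>X\<in>P. card X = n"
    using Suc.IH[of "V - X"] Suc.prems by auto
  have "partition_on V (insert X P)"
    using P(1) X Suc.prems(3) partition_onD1[OF P(1)]
    by (subst partition_on_insert) (auto simp: disjnt_def)
  moreover have "X \<notin> P"
  proof
    assume "X \<in> P"
    then have "X = {}"
      using partition_onD1[OF P(1)] by blast
    then show False
      using X(2) Suc.prems(3) by auto
  qed
  moreover have "finite P"
    using P(1) Suc.prems(1) finite_elements by blast
  ultimately show ?case
    using P X by (intro exI[of _ "insert X P"]) auto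
qed

text \<open>Passes from the real quotient to natural numbers; \<open>n \<ge> 2\<close> keeps
  \<open>n - 2\<close> from being truncated.\<close>

lemma extremal_length_eq:
  assumes "n \<ge> 2" and "m = k * n"
  shows "real l = real m * (real n - 2) / real n \<longleftrightarrow> l = k * (n - 2)"
proof -
  have "real m * (real n - 2) / real n = real (k * (n - 2))"
    using assms by (simp add: of_nat_diff)
  then show ?thesis
    by (simp only: of_nat_eq_iff)
qed

text \<open>The index classes of the parts are disjoint and their sizes add up to the number of
  indices, so no index is left over.\<close>

lemma partition_covers_members:
  assumes fin: "finite V" and P: "partition_on V P"
    and cnt: "\<And>X. X \<in> P \<Longrightarrow> card {i. i < length Ts \<and> uverts (Ts ! i) = X} = c"
    and len: "length Ts = card P * c" and i: "i < length Ts"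
  shows "uverts (Ts ! i) \<in> P"
proof -
  let ?I = "\<lambda>X. {i. i < length Ts \<and> uverts (Ts ! i) = X}"
  have "card (\<Union>X\<in>P. ?I X) = (\<Sum>X\<in>P. card (?I X))"
    using finite_elements[OF fin P] by (intro card_UN_disjoint) auto
  also have "\<dots> = card {..<length Ts}"
    using cnt len by simp
  finally have "(\<Union>X\<in>P. ?I X) = {..<length Ts}"
    by (intro card_subset_eq) auto
  then show ?thesis
    using i by blast
qed

text \<open>Each edge of a rainbow tree lies in a member and hence in one part, so by connectedness
  the whole tree lies in one part. Its at least \<open>n - 1\<close> edges would need distinct
  colours among \<open>n - 2\<close> indices.\<close>

lemma no_rainbow_if_partition:
  assumes n: "n \<ge> 2" and P: "partition_on V P"
    and Ts: "\<And>i. i < length Ts \<Longrightarrow> tree_on V (Ts ! i)"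
    and cover: "\<And>i. i < length Ts \<Longrightarrow> uverts (Ts ! i) \<in> P"
    and cnt: "\<And>X. X \<in> P \<Longrightarrow> card {i. i < length Ts \<and> uverts (Ts ! i) = X} = n - 2"
  shows "\<not> contains_rainbow_tree V Ts n"
proof
  assume "contains_rainbow_tree V Ts n"
  then obtain S f where S: "tree_on V S" "graph_order S = n" "inj_on f (uedges S)"
    and f: "\<And>e. e \<in> uedges S \<Longrightarrow> f e < length Ts \<and> e \<in> uedges (Ts ! f e)"
    unfolding contains_rainbow_tree_def by blast
  have conn: "connected_graph S" and simple: "simple_graph S" and sub: "uverts S \<subseteq> V"
    using S(1) by (auto simp: tree_on_def is_tree_def)
  have edge: "e \<subseteq> uverts (Ts ! f e)" if "e \<in> uedges S" for e
    using f[OF that] Ts by (auto simp: tree_on_def is_tree_def simple_graph_def)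
  obtain v where "v \<in> uverts S"
    using conn by (auto simp: connected_graph_def)
  then obtain X where v: "v \<in> uverts S" "v \<in> X" "X \<in> P"
    using sub partition_onD1[OF P] by blast
  have part: "uverts (Ts ! f e) = X" if "e \<in> uedges S" "e \<inter> X \<noteq> {}" for e
  proof -
    have "uverts (Ts ! f e) \<in> P"
      using cover f[OF that(1)] by blast
    moreover have "uverts (Ts ! f e) \<inter> X \<noteq> {}"
      using edge[OF that(1)] that(2) by blast
    ultimately show ?thesis
      using disjointD[OF partition_onD2[OF P]] v(3) by blast
  qed
  have "uverts S \<subseteq> X"
  proof (rule ccontr)
    assume "\<not> uverts S \<subseteq> X"
    then obtain x y where "{x, y} \<in> uedges S" "x \<in> X" "y \<notin> X"
      using connected_graph_crossing_edge[OF conn, of X] v by blast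
    then show False
      using part[of "{x, y}"] edge[of "{x, y}"] by auto
  qed
  moreover have "e \<subseteq> uverts S" "e \<noteq> {}" if "e \<in> uedges S" for e
    using simple that by (auto simp: simple_graph_def)
  ultimately have "e \<inter> X \<noteq> {}" if "e \<in> uedges S" for e
    using that by (metis Int_absorb2 order_trans)
  then have "f ` uedges S \<subseteq> {i. i < length Ts \<and> uverts (Ts ! i) = X}"
    using part f by auto
  then have "card (f ` uedges S) \<le> n - 2"
    using card_mono[of "{i. i < length Ts \<and> uverts (Ts ! i) = X}" "f ` uedges S"] cnt[OF v(3)]
    by simp
  then have "card (uedges S) \<le> n - 2"
    using card_image[OF S(3)] by simp
  then show False
    using connected_graph_card_le[OF conn simple] S(2) n by linarith
qed

text \<open>The definition only counts the members on each part; comparing with the total length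
  shows that every member spans a part and so has order \<open>n\<close>.\<close>

lemma extremal_collectionsD:
  assumes n: "n \<ge> 2" and m: "m = k * n" and V: "finite V"
    and Ts: "Ts \<in> extremal_collections V n m"
  shows "\<forall>T\<in>set Ts. tree_on V T \<and> graph_order T = n" "\<not> contains_rainbow_tree V Ts n"
proof -
  obtain P where P: "partition_on V P" "real (card P) = real m / real n" "\<forall>X\<in>P. card X = n"
    and cnt: "\<forall>X\<in>P. int (card {i. i < length Ts \<and> uverts (Ts ! i) = X}) = int n - 2"
    and tree: "\<forall>T\<in>set Ts. tree_on V T"
    and len: "real (length Ts) = real m * (real n - 2) / real n"
    using Ts unfolding extremal_collections_def by blast
  have "card P = k"
    using P(2) m n by simp
  moreover have "length Ts = k * (n - 2)"
    using len extremal_length_eq[OF n m] by blast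
  moreover have cnt': "card {i. i < length Ts \<and> uverts (Ts ! i) = X} = n - 2" if "X \<in> P" for X
    using cnt that by fastforce
  ultimately have cover: "uverts (Ts ! i) \<in> P" if "i < length Ts" for i
    using partition_covers_members[OF V P(1)] that by blast
  then show "\<forall>T\<in>set Ts. tree_on V T \<and> graph_order T = n"
    using tree P(3) by (metis in_set_conv_nth)
  show "\<not> contains_rainbow_tree V Ts n"
    using no_rainbow_if_partition[OF n P(1) _ cover cnt'] tree by simp
qed

text \<open>Equality in the double count forces every degree to be \<open>n - 2\<close>; the vertex
  sets of the members then form the required partition.\<close>

lemma extremal_collectionsI:
  assumes n: "n \<ge> 2" and m: "m = k * n" and V: "finite V" "card V = m"
    and Ts: "\<forall>T\<in>set Ts. tree_on V T \<and> graph_order T = n"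
    and no_rainbow: "\<not> contains_rainbow_tree V Ts n"
    and len: "length Ts = k * (n - 2)"
  shows "Ts \<in> extremal_collections V n m"
proof -
  have "\<exists>P. partition_on V P \<and> card P = k \<and> (\<forall>X\<in>P. card X = n) \<and>
    (\<forall>X\<in>P. card {i. i < length Ts \<and> uverts (Ts ! i) = X} = n - 2)"
  proof (cases "n = 2")
    \<comment> \<open>The collection is empty here, so any partition into pairs serves.\<close>
    case True
    then show ?thesis
      using ex_partition_on_equal_card[OF V(1), of k n] V(2) m len by auto
  next
    case False
    have le: "card (members_at Ts v) \<le> n - 2" if "v \<in> V" for v
      using card_members_at_le[OF Ts no_rainbow that] n by linarith
    have "(\<Sum>v\<in>V. card (members_at Ts v)) = (\<Sum>v\<in>V. n - 2)"
      using sum_card_members_at[OF V(1) Ts] V(2) len m by simp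
    \<comment> \<open>A termwise bound with equal sums is an equality in every term.\<close>
    then have "card (members_at Ts v) = n - 2" if "v \<in> V" for v
      using sum_mono_inv[OF _ le that V(1)] by simp
    then have deg: "card (members_at Ts v) + 2 = n" if "v \<in> V" for v
      using that n by simp
    define P where "P = (\<lambda>i. uverts (Ts ! i)) ` {..<length Ts}"
    have tree: "uverts (Ts ! i) \<subseteq> V" "card (uverts (Ts ! i)) = n" if "i < length Ts" for i
      using Ts that by (auto simp: tree_on_def)
    have same: "members_at Ts v = {j. j < length Ts \<and> uverts (Ts ! j) = uverts (Ts ! i)}"
      if i: "i < length Ts" and v: "v \<in> uverts (Ts ! i)" for i v
    proof -
      \<comment> \<open>Stated for fresh \<open>i\<close> and \<open>j\<close>, so that exchanging
        them gives the reverse inclusion.\<close>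
      have "uverts (Ts ! j) \<subseteq> uverts (Ts ! i)"
        if "i < length Ts" "j < length Ts" "v \<in> uverts (Ts ! i)" "v \<in> uverts (Ts ! j)" for i j
      proof
        fix w assume "w \<in> uverts (Ts ! j)"
        then have "members_at Ts w = members_at Ts v"
          using members_at_eq_on_member[OF Ts no_rainbow deg] that by blast
        then show "w \<in> uverts (Ts ! i)"
          using that by (auto simp: members_at_def)
      qed
      then show ?thesis
        using i v by (fastforce simp: members_at_def)
    qed
    \<comment> \<open>Now \<open>n \<ge> 3\<close>, so degrees are positive and the members cover
      \<open>V\<close>.\<close>
    have ne: "members_at Ts v \<noteq> {}" if "v \<in> V" for v
      using deg[OF that] n False by auto
    have part: "partition_on V P"
    proof (rule partition_onI)
      show "\<Union>P = V"
        using ne tree(1) by (fastforce simp: P_def members_at_def)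
      show "{} \<notin> P"
        using tree(2) n by (fastforce simp: P_def)
      show "disjnt X Y" if XY: "X \<in> P" "Y \<in> P" "X \<noteq> Y" for X Y
      proof (rule ccontr)
        assume "\<not> disjnt X Y"
        then obtain v where "v \<in> X" "v \<in> Y"
          by (auto simp: disjnt_def)
        then show False
          using XY same by (auto simp: P_def members_at_def)
      qed
    qed
    have card_n: "\<forall>X\<in>P. card X = n"
      using tree(2) by (auto simp: P_def)
    have "n * card P = card (\<Union>P)"
      using card_n V(1) partition_onD1[OF part] partition_onD2[OF part]
      by (intro card_partition) (auto simp: P_def dest: disjointD)
    then have "card P = k"
      using partition_onD1[OF part] V(2) m n by simp
    moreover have "card {i. i < length Ts \<and> uverts (Ts ! i) = X} = n - 2" if "X \<in> P" for X
    proof -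
      obtain i where i: "i < length Ts" "X = uverts (Ts ! i)"
        using \<open>X \<in> P\<close> by (auto simp: P_def)
      then obtain v where v: "v \<in> X"
        using tree(2) n by fastforce
      show ?thesis
        using same[OF i(1)] i deg[of v] tree(1) v by fastforce
    qed
    ultimately show ?thesis
      using part card_n by blast
  qed
  then obtain P where "partition_on V P" "card P = k" "\<forall>X\<in>P. card X = n"
    "\<forall>X\<in>P. card {i. i < length Ts \<and> uverts (Ts ! i) = X} = n - 2"
    by blast
  moreover have "real k = real m / real n"
    using m n by simp
  ultimately show ?thesis
    using Ts len extremal_length_eq[OF n m, of "length Ts"] n
    unfolding extremal_collections_def by (auto simp: of_nat_diff)
qed

section \<open>The bound and its attainment\<close>

lemma length_le:
  assumes n: "n > 0" and V: "finite V" "card V = m" "m > 0"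
    and Ts: "\<forall>T\<in>set Ts. tree_on V T \<and> graph_order T = n"
    and no_rainbow: "\<not> contains_rainbow_tree V Ts n"
  shows "n \<ge> 2" "real (length Ts) \<le> real m * (real n - 2) / real n"
proof -
  have le: "card (members_at Ts v) + 2 \<le> n" if "v \<in> V" for v
    using card_members_at_le[OF Ts no_rainbow that n] .
  obtain v where "v \<in> V"
    using V by fastforce
  then show n2: "n \<ge> 2"
    using le by fastforce
  have "(\<Sum>v\<in>V. card (members_at Ts v)) \<le> (\<Sum>v\<in>V. n - 2)"
    using le by (intro sum_mono) fastforce
  then have "length Ts * n \<le> m * (n - 2)"
    using sum_card_members_at[OF V(1) Ts] V(2) by simp
  then have "real (length Ts) * real n \<le> real m * (real n - 2)"
    using n2 by (metis of_nat_diff of_nat_le_iff of_nat_mult of_nat_numeral)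
  then show "real (length Ts) \<le> real m * (real n - 2) / real n"
    using n by (simp add: pos_le_divide_eq)
qed

text \<open>Since \<open>h\<close> recovers \<open>y\<close> from \<open>g y\<close>, only the block
  of \<open>x\<close> contributes. In the application \<open>g\<close> picks a spanning tree and
  \<open>h\<close> is the vertex set.\<close>

lemma card_replicated_blocks:
  assumes "distinct xs" "x \<in> set xs" "\<And>y. y \<in> set xs \<Longrightarrow> h (g y) = y"
  shows "card {i. i < length (concat (map (\<lambda>x. replicate c (g x)) xs)) \<and>
    h (concat (map (\<lambda>x. replicate c (g x)) xs) ! i) = x} = c"
proof -
  have "length (filter (\<lambda>T. h T = x) (concat (map (\<lambda>x. replicate c (g x)) xs))) =
    (if x \<in> set xs then c else 0)"
    using assms(1,3) by (induction xs) (auto simp: filter_replicate)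
  then show ?thesis
    using assms(2) by (simp add: length_filter_conv_card)
qed

text \<open>Takes \<open>n - 2\<close> copies of one spanning tree for each part, as members may
  repeat.\<close>

lemma extremal_collections_nonempty:
  assumes n: "n \<ge> 2" and m: "m = k * n" and V: "finite V" "card V = m"
  shows "extremal_collections V n m \<noteq> {}"
proof -
  obtain P where P: "partition_on V P" "card P = k" "\<forall>X\<in>P. card X = n"
    using ex_partition_on_equal_card[OF V(1), of k n] V(2) m n by auto
  obtain Xs where Xs: "set Xs = P" "distinct Xs"
    using finite_distinct_list[OF finite_elements[OF V(1) P(1)]] by blast
  have "\<exists>T. is_tree T \<and> uverts T = X" if "X \<in> P" for X
    using P(3) that n by (intro ex_is_tree_spanning) (auto intro: card_ge_0_finite)
  then obtain g where g: "\<And>X. X \<in> P \<Longrightarrow> is_tree (g X) \<and> uverts (g X) = X"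
    by metis
  define Ts where "Ts = concat (map (\<lambda>X. replicate (n - 2) (g X)) Xs)"
  have "length Ts = k * (n - 2)"
    using P(2) Xs distinct_card[OF Xs(2)]
    by (simp add: Ts_def length_concat comp_def sum_list_triv)
  then have "real (length Ts) = real m * (real n - 2) / real n"
    using extremal_length_eq[OF n m] by blast
  moreover have "card {i. i < length Ts \<and> uverts (Ts ! i) = X} = n - 2" if "X \<in> P" for X
    unfolding Ts_def using Xs g that by (intro card_replicated_blocks) auto
  moreover have "\<forall>T\<in>set Ts. tree_on V T"
    using g Xs partition_onD1[OF P(1)] by (auto simp: Ts_def tree_on_def)
  moreover have "real (card P) = real m / real n"
    using P(2) m n by simp
  ultimately have "Ts \<in> extremal_collections V n m"
    using P n unfolding extremal_collections_def by (auto simp: of_nat_diff)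
  then show ?thesis
    by blast
qed

text \<open>The prescribed length would be \<open>- m\<close>, which is negative.\<close>

lemma extremal_collections_1:
  assumes "m > 0"
  shows "extremal_collections V 1 m = {}"
  using assms by (auto simp: extremal_collections_def)

theorem theorem1p2:
  fixes V :: "'a set" and m n :: nat
  assumes "m > 0" and "n > 0" and "n dvd m"
    and "finite V" and "card V = m"
  shows "(\<forall>Ts. (\<forall>T\<in>set Ts. tree_on V T \<and> graph_order T = n) \<and> \<not> contains_rainbow_tree V Ts n
            \<longrightarrow> real (length Ts) \<le> real m * (real n - 2) / real n)
       \<and> (n \<ge> 2 \<longrightarrow>
            (\<exists>Ts. (\<forall>T\<in>set Ts. tree_on V T \<and> graph_order T = n) \<and> \<not> contains_rainbow_tree V Ts n
              \<and> real (length Ts) = real m * (real n - 2) / real n))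
       \<and> {Ts. (\<forall>T\<in>set Ts. tree_on V T \<and> graph_order T = n) \<and> \<not> contains_rainbow_tree V Ts n
              \<and> real (length Ts) = real m * (real n - 2) / real n}
          = extremal_collections V n m"
proof -
  obtain k where m: "m = k * n"
    using assms(3) by (metis dvdE mult.commute)
  let ?A = "{Ts. (\<forall>T\<in>set Ts. tree_on V T \<and> graph_order T = n) \<and> \<not> contains_rainbow_tree V Ts n
              \<and> real (length Ts) = real m * (real n - 2) / real n}"
  have bound: "n \<ge> 2" "real (length Ts) \<le> real m * (real n - 2) / real n"
    if "\<forall>T\<in>set Ts. tree_on V T \<and> graph_order T = n" "\<not> contains_rainbow_tree V Ts n" for Ts
    using length_le[OF assms(2,4,5,1) that] by blast+
  have eq: "?A = extremal_collections V n m"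
  proof (cases "n \<ge> 2")
    case True
    have "?A \<subseteq> extremal_collections V n m"
      using extremal_collectionsI[OF True m assms(4,5)] extremal_length_eq[OF True m] by blast
    moreover have "extremal_collections V n m \<subseteq> ?A"
      using extremal_collectionsD[OF True m assms(4)] by (auto simp: extremal_collections_def)
    ultimately show ?thesis
      by blast
  next
    case False
    \<comment> \<open>Both sets are empty: a single vertex is already a rainbow tree of order 1, so
      \<open>bound(1)\<close> rules out every collection on the left.\<close>
    then have "n = 1"
      using assms(2) by simp
    then show ?thesis
      using bound(1) False extremal_collections_1[OF assms(1)] by blast
  qed
  moreover have "?A \<noteq> {}" if "n \<ge> 2"
    using extremal_collections_nonempty[OF that m assms(4,5)] eq by simp
  ultimately show ?thesis
    using bound(2) by blast
qed

end
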